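(* Let $k>0$. Let $u_0(x)$ be a non-identically-zero function on $\mathbb{R}$ with compact support in the interval $[\alpha_0,\beta_0]$. Let $s_0=\beta_0-\alpha_0$ and let $z_0$ be a global minimum point of $u_0'(x)$. Denote by $u(t,x)$ the solution of $$u_t+uu_x=ku^2$$ with initial datum $u(0,x)=u_0(x)$, and by $X(t,z)$ the characteristic curve starting from $z$. (1) If $s_0\le k^{-1}$, then $u(t,x)$ or $u_x(t,x)$ must blow up on the characteristic curve $X(t,z_0)$. (2) If $s_0>k^{-1}$, then there exists a certain $u_0(x)$ such that $u(t,x)$ and $u_x(t,x)$ exist globally on the characteristic curve $X(t,z_0)$.
   Context: The characteristic curve $X(t,z)$ is defined by $\frac{\mathrm{d}}{\mathrm{d}t}X(t,z)=u(t,X(t,z))$, $X(0,z)=z$. In (2), the function $u_0$ whose existence is asserted is again non-identically-zero with compact support in $[\alpha_0,\beta_0]$, and $z_0$ is a global minimum point of its derivative $u_0'$. "Blow up" means blow up in finite time; "exist globally" means for all $t\ge0$. *)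

theory Defs
  imports "HOL-Analysis.Analysis"
begin

definition initial_datum :: "real \<Rightarrow> real \<Rightarrow> (real \<Rightarrow> real) \<Rightarrow> bool" where
  "initial_datum \<alpha> \<beta> u0 \<longleftrightarrow>
     u0 C1_differentiable_on UNIV \<and> (\<exists>x. u0 x \<noteq> 0) \<and> closure {x. u0 x \<noteq> 0} \<subseteq> {\<alpha>..\<beta>}"

definition global_min_point :: "(real \<Rightarrow> real) \<Rightarrow> real \<Rightarrow> bool" where
  "global_min_point f z \<longleftrightarrow> (\<forall>x. f z \<le> f x)"

text \<open>
  Classical (C1 up to time 0) solution of u_t + u u_x = k u^2 on a region D of the half plane
  t \<ge> 0 which is relatively open and contains the whole initial line.  The region is not required
  to be a strip: for every datum as above the function u0' - k u0 is negative somewhere, so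
  no C1 solution exists on the whole half plane, and one may break down away from a given
  characteristic before, or without, breaking down on it.  Since D is relatively open, the derivative
  in x is two-sided, and the derivative in t is one-sided only at t = 0.
\<close>
definition classical_solution ::
    "real \<Rightarrow> (real \<Rightarrow> real) \<Rightarrow> (real \<times> real) set \<Rightarrow> (real \<Rightarrow> real \<Rightarrow> real) \<Rightarrow> bool" where
  "classical_solution k u0 D u \<longleftrightarrow>
     openin (top_of_set ({0..} \<times> UNIV)) D \<and> {0} \<times> UNIV \<subseteq> D \<and>
     (\<forall>x. u 0 x = u0 x) \<and>
     (\<exists>ut ux. continuous_on D (\<lambda>(t, x). ut t x) \<and> continuous_on D (\<lambda>(t, x). ux t x) \<and>
        (\<forall>(t, x)\<in>D.
           ((\<lambda>s. u s x) has_real_derivative ut t x) (at t within {0..}) \<and>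
           ((\<lambda>y. u t y) has_real_derivative ux t x) (at x) \<and>
           ut t x + u t x * ux t x = k * (u t x)\<^sup>2))"

text \<open>X is the characteristic curve starting from z, staying in the domain D of u for times in J.\<close>
definition characteristic ::
    "(real \<times> real) set \<Rightarrow> (real \<Rightarrow> real \<Rightarrow> real) \<Rightarrow> real set \<Rightarrow> real \<Rightarrow> (real \<Rightarrow> real) \<Rightarrow> bool" where
  "characteristic D u J z X \<longleftrightarrow>
     X 0 = z \<and>
     (\<forall>t\<in>J. (t, X t) \<in> D \<and> (X has_real_derivative u t (X t)) (at t within J))"

definition blows_up_at :: "(real \<Rightarrow> real) \<Rightarrow> real \<Rightarrow> bool" where
  "blows_up_at f T \<longleftrightarrow> filterlim (\<lambda>t. \<bar>f t\<bar>) at_top (at_left T)"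

text \<open>
  The first conjunct under the quantifier says that the solution does live on the characteristic up
  to time T, so that the second one is not vacuous.
\<close>
definition blows_up_on_characteristic :: "real \<Rightarrow> (real \<Rightarrow> real) \<Rightarrow> real \<Rightarrow> bool" where
  "blows_up_on_characteristic k u0 z \<longleftrightarrow>
     (\<exists>T>0.
        (\<exists>D u X. classical_solution k u0 D u \<and> characteristic D u {0..<T} z X) \<and>
        (\<forall>D u X. classical_solution k u0 D u \<and> characteristic D u {0..<T} z X \<longrightarrow>
           blows_up_at (\<lambda>t. u t (X t)) T \<or> blows_up_at (\<lambda>t. deriv (u t) (X t)) T))"

definition exists_globally_on_characteristic :: "real \<Rightarrow> (real \<Rightarrow> real) \<Rightarrow> real \<Rightarrow> bool" where
  "exists_globally_on_characteristic k u0 z \<longleftrightarrow>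
     (\<exists>D u X. classical_solution k u0 D u \<and> characteristic D u {0..} z X)"

end

theory Submission imports Defs begin

text \<open>
  Along a characteristic the equation reads U' = k U^2, so the characteristic from z is
  Y(t,z) = z - ln (1 - k u0(z) t) / k and carries the value W(t,z) = u0(z) / (1 - k u0(z) t).
  Differentiating both in z gives u_x = u0' / ((1 - k u0 t) (1 + (u0' - k u0) t)).  At a point z0 with
  u0'(z0) < 0 the second factor vanishes first as soon as u0'(z0) < k u0(z0), which is blow-up of
  u_x; if instead k u0(z0) \<le> u0'(z0) < 0 neither factor vanishes.  The latter would force
  |u0(z0)| \<ge> |u0'(z0)| / k, but by the mean value theorem a function that starts from 0 with slopes
  at least u0'(z0) needs length 1/k to get there, and z0 is strictly inside the support.  Conversely
  a support longer than 1/k leaves room for a descent whose slope is nearly constant and steepest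
  at its very end.

  Since u is only C1, u_x cannot be followed by an ODE along the characteristic.  Instead
  u = W is shown on all nearby explicit curves Y, and u_x is obtained by differentiating in z.
\<close>

section \<open>Gluing functions at a point, and uniqueness for linear equations\<close>

lemma DERIV_paste:
  fixes f g f' g' :: "real \<Rightarrow> real"
  assumes f: "\<And>x. x \<le> c \<Longrightarrow> (f has_real_derivative f' x) (at x)"
    and g: "\<And>x. x \<ge> c \<Longrightarrow> (g has_real_derivative g' x) (at x)"
    and "f c = g c" "f' c = g' c"
  shows "((\<lambda>x. if x \<le> c then f x else g x) has_real_derivative
    (if x \<le> c then f' x else g' x)) (at x)"
proof -
  have cl: "closure {c<..} = {c..}"
    by (simp add: closure_greaterThan)
  have "((\<lambda>x. if x \<in> {..c} then f x else g x) has_vector_derivative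
    (if x \<in> {..c} then f' x else g' x)) (at x within UNIV)"
    \<comment> \<open>The closures of the two half-lines share exactly \<open>c\<close>, where
      matching value and slope are required.\<close>
    by (rule has_vector_derivative_If_within_closures[where T = "{c<..}"])
      (use assms in \<open>auto simp: cl has_real_derivative_iff_has_vector_derivative
         intro: has_vector_derivative_at_within\<close>)
  then show ?thesis
    by (simp add: has_real_derivative_iff_has_vector_derivative)
qed

lemma continuous_on_paste:
  fixes f g :: "real \<Rightarrow> real"
  assumes "continuous_on {..c} f" "continuous_on {c..} g" "f c = g c"
  shows "continuous_on UNIV (\<lambda>x. if x \<le> c then f x else g x)"
proof -
  have "continuous_on ({..c} \<union> {c..}) (\<lambda>x. if x \<le> c then f x else g x)"
    by (rule continuous_on_cases) (use assms in auto)
  also have "{..c} \<union> {c..} = UNIV" by auto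
  finally show ?thesis .
qed

text \<open>With \<open>G\<close> an antiderivative of \<open>g\<close>, the integrating factor
  \<open>exp (- G s)\<close> turns \<open>e\<close> into a constant. The uniqueness claims along
  characteristics reduce to this by letting \<open>e\<close> be a difference of two
  candidates.\<close>

lemma linear_ode_zero:
  fixes e g :: "real \<Rightarrow> real"
  assumes e: "\<And>s. s \<in> {0..t} \<Longrightarrow> (e has_real_derivative g s * e s) (at s within {0..t})"
    and g: "continuous_on {0..t} g" and "e 0 = 0" "s \<in> {0..t}"
  shows "e s = 0"
proof -
  obtain G where G: "\<And>s. s \<in> {0..t} \<Longrightarrow> (G has_vector_derivative g s) (at s within {0..t})"
    using antiderivative_continuous[OF g] by blast
  have "((\<lambda>s. e s * exp (- G s)) has_real_derivative 0) (at s within {0..t})"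
    if "s \<in> {0..t}" for s
    using e[OF that] G[OF that] unfolding has_real_derivative_iff_has_vector_derivative[symmetric]
    by (auto intro!: derivative_eq_intros)
  then have "\<exists>c. \<forall>s\<in>{0..t}. e s * exp (- G s) = c"
    by (intro has_field_derivative_zero_constant) auto
  then obtain c where c: "\<And>s. s \<in> {0..t} \<Longrightarrow> e s * exp (- G s) = c"
    by blast
  have "e s * exp (- G s) = e 0 * exp (- G 0)"
    using c[of s] c[of 0] assms(4) by auto
  then show ?thesis
    using assms(3) by simp
qed

section \<open>Joint differentiability of classical solutions and the chain rule along
  curves\<close>

text \<open>The t partial at a point, together with an x partial that is continuous on a box around
  it, gives joint differentiability, as the chain rule along a curve demands. The derivative is
  taken within the closed half plane, so time 0 is covered.\<close>

lemma classical_solutionE: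
  assumes "classical_solution k u0 D u"
  obtains ut ux where
    "continuous_on D (\<lambda>(t, x). ux t x)"
    "\<And>t x. (t, x) \<in> D \<Longrightarrow>
       ((\<lambda>(t, x). u t x) has_derivative (\<lambda>(\<tau>, \<xi>). ut t x * \<tau> + ux t x * \<xi>))
         (at (t, x) within {0..} \<times> UNIV)"
    "\<And>t x. (t, x) \<in> D \<Longrightarrow> (u t has_real_derivative ux t x) (at x)"
    "\<And>t x. (t, x) \<in> D \<Longrightarrow> ut t x + u t x * ux t x = k * (u t x)\<^sup>2"
proof -
  obtain ut ux where ux: "continuous_on D (\<lambda>(t, x). ux t x)"
    and sol: "\<And>t x. (t, x) \<in> D \<Longrightarrow>
           ((\<lambda>s. u s x) has_real_derivative ut t x) (at t within {0..}) \<and>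
           ((\<lambda>y. u t y) has_real_derivative ux t x) (at x) \<and>
           ut t x + u t x * ux t x = k * (u t x)\<^sup>2"
    using assms unfolding classical_solution_def by (elim conjE exE) (force simp: Ball_def)
  have opn: "openin (top_of_set ({0..} \<times> UNIV)) D"
    using assms unfolding classical_solution_def by auto
  have "((\<lambda>(t, x). u t x) has_derivative (\<lambda>(\<tau>, \<xi>). ut t x * \<tau> + ux t x * \<xi>))
         (at (t, x) within {0..} \<times> UNIV)" if tx: "(t, x) \<in> D" for t x
  proof -
    obtain U where U: "open U" "D = ({0..} \<times> UNIV) \<inter> U"
      using opn by (auto simp: openin_open)
    then obtain A B where AB: "open A" "open B" "t \<in> A" "x \<in> B" "A \<times> B \<subseteq> U"
      using tx by (auto elim!: open_prod_elim)
    \<comment> \<open>The theorem on partial derivatives wants a convex factor in x, hence a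
      ball.\<close>
    obtain r where r: "r > 0" "ball x r \<subseteq> B"
      using AB open_contains_ball by blast
    have sub: "({0..} \<inter> A) \<times> ball x r \<subseteq> D"
      using U AB r by auto
    have "((\<lambda>(t, x). u t x) has_derivative
         (\<lambda>(\<tau>, \<xi>). ut t x * \<tau> + blinfun_apply (blinfun_mult_right (ux t x)) \<xi>))
         (at (t, x) within ({0..} \<inter> A) \<times> ball x r)"
    proof (rule has_derivative_partialsI[where fy = "\<lambda>t x. blinfun_mult_right (ux t x)"])
      show "((\<lambda>t. u t x) has_derivative (*) (ut t x)) (at t within {0..} \<inter> A)"
        using sol[OF tx] by (auto simp: has_field_derivative_def intro: has_derivative_subset)
      show "((\<lambda>z. u s z) has_derivative blinfun_apply (blinfun_mult_right (ux s y)))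
              (at y within ball x r)"
        if "s \<in> {0..} \<inter> A" "y \<in> ball x r" for s y
      proof -
        have "(s, y) \<in> D"
          using that sub by blast
        from sol[OF this] show ?thesis
          by (auto simp: has_field_derivative_def intro: has_derivative_at_withinI)
      qed
      have "continuous_on (({0..} \<inter> A) \<times> ball x r) (\<lambda>p. blinfun_mult_right (case p of (t, x) \<Rightarrow> ux t x))"
        by (intro bounded_linear.continuous_on[OF bounded_linear_blinfun_mult_right]
            continuous_on_subset[OF ux sub])
      moreover have "(t, x) \<in> ({0..} \<inter> A) \<times> ball x r"
        using tx U AB r by auto
      ultimately show "continuous (at (t, x) within ({0..} \<inter> A) \<times> ball x r)
          (\<lambda>(t, x). blinfun_mult_right (ux t x))"
        by (auto simp: continuous_on_eq_continuous_within case_prod_unfold)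
    qed (use r in auto)
    moreover have "at (t, x) within ({0..} \<inter> A) \<times> ball x r = at (t, x) within {0..} \<times> UNIV"
      by (rule at_within_nhd[of _ "A \<times> ball x r"]) (use AB r in \<open>auto intro: open_Times\<close>)
    ultimately show ?thesis
      by simp
  qed
  from that[OF ux this] show ?thesis
    using sol by blast
qed

lemma has_derivative_along_curve:
  fixes u :: "real \<Rightarrow> real \<Rightarrow> real"
  assumes u: "((\<lambda>(t, x). u t x) has_derivative (\<lambda>(\<tau>, \<xi>). a * \<tau> + b * \<xi>))
         (at (s, c s) within {0..} \<times> UNIV)"
    and c: "(c has_real_derivative v) (at s within S)" and S: "S \<subseteq> {0..}"
  shows "((\<lambda>s. u s (c s)) has_real_derivative a + b * v) (at s within S)"
proof -
  have d: "((\<lambda>s. (s, c s)) has_derivative (\<lambda>h. (h, v * h))) (at s within S)"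
    using c by (auto simp: has_field_derivative_def intro!: derivative_eq_intros)
  have sub: "(\<lambda>s. (s, c s)) ` S \<subseteq> {0..} \<times> UNIV"
    using S by auto
  have "((\<lambda>s. u s (c s)) has_derivative (\<lambda>h. a * h + b * (v * h))) (at s within S)"
    using has_derivative_in_compose[OF d has_derivative_subset[OF u sub]] by simp
  moreover have "(\<lambda>h. a * h + b * (v * h)) = (*) (a + b * v)"
    by (auto simp: algebra_simps)
  ultimately show ?thesis
    by (simp add: has_field_derivative_def)
qed

section \<open>Explicit characteristics and the values they carry\<close>

locale burgers_datum =
  fixes k :: real and u0 u0' :: "real \<Rightarrow> real"
  assumes k_pos: "k > 0"
    and deriv_u0: "\<And>x. (u0 has_real_derivative u0' x) (at x)"
    and cont_u0': "continuous_on UNIV u0'"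
begin

text \<open>The derivative of Y in z is B / A; Y and W are meaningful only where A is positive.\<close>

definition A :: "real \<Rightarrow> real \<Rightarrow> real" where "A t z = 1 - k * u0 z * t"
definition B :: "real \<Rightarrow> real \<Rightarrow> real" where "B t z = 1 + (u0' z - k * u0 z) * t"
definition W :: "real \<Rightarrow> real \<Rightarrow> real" where "W t z = u0 z / A t z"
definition Y :: "real \<Rightarrow> real \<Rightarrow> real" where "Y t z = z - ln (A t z) / k"

lemma cont_u0: "continuous_on UNIV u0"
  using deriv_u0 by (auto simp: continuous_on_eq_continuous_within intro: DERIV_isCont)

lemma continuous_on_u0 [continuous_intros]:
  "continuous_on S f \<Longrightarrow> continuous_on S (\<lambda>x. u0 (f x))"
  using continuous_on_compose2[OF cont_u0] by auto

lemma continuous_on_u0' [continuous_intros]: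
  "continuous_on S f \<Longrightarrow> continuous_on S (\<lambda>x. u0' (f x))"
  using continuous_on_compose2[OF cont_u0'] by auto

lemma continuous_on_A [continuous_intros]:
  "continuous_on S f \<Longrightarrow> continuous_on S g \<Longrightarrow> continuous_on S (\<lambda>x. A (f x) (g x))"
  unfolding A_def by (intro continuous_intros)

lemma continuous_on_B [continuous_intros]:
  "continuous_on S f \<Longrightarrow> continuous_on S g \<Longrightarrow> continuous_on S (\<lambda>x. B (f x) (g x))"
  unfolding B_def by (intro continuous_intros)

lemma continuous_on_Y [continuous_intros]:
  assumes "continuous_on S f" "continuous_on S g" "\<And>x. x \<in> S \<Longrightarrow> A (f x) (g x) > 0"
  shows "continuous_on S (\<lambda>x. Y (f x) (g x))"
  using k_pos assms(3) unfolding Y_def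
  by (intro continuous_intros assms(1,2)) force+

lemma continuous_on_W [continuous_intros]:
  assumes "continuous_on S f" "continuous_on S g" "\<And>x. x \<in> S \<Longrightarrow> A (f x) (g x) > 0"
  shows "continuous_on S (\<lambda>x. W (f x) (g x))"
  using assms(3) unfolding W_def
  by (intro continuous_intros assms(1,2)) force+

lemma has_derivative_u0_snd:
  "((\<lambda>p. u0 (snd p)) has_derivative (\<lambda>h. u0' (snd p) * snd h)) (at p)"
  using has_derivative_compose[OF has_derivative_snd[OF has_derivative_ident], of u0 "(*) (u0' (snd p))" p UNIV]
    deriv_u0[of "snd p"] by (simp add: has_field_derivative_def)

lemma has_derivative_A:
  "((\<lambda>p. A (fst p) (snd p)) has_derivative
     (\<lambda>h. - k * u0 (snd p) * fst h - k * u0' (snd p) * fst p * snd h)) (at p)"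
  unfolding A_def
  by (auto intro!: derivative_eq_intros has_derivative_u0_snd simp: algebra_simps)

text \<open>In the z part the numerator is \<open>u0' * A + k * u0 * u0' * t\<close>, where the
  terms in \<open>t\<close> cancel and \<open>u0'\<close> remains.\<close>

lemma has_derivative_W:
  assumes "A (fst p) (snd p) > 0"
  shows "((\<lambda>p. W (fst p) (snd p)) has_derivative
     (\<lambda>h. k * (W (fst p) (snd p))\<^sup>2 * fst h + u0' (snd p) / (A (fst p) (snd p))\<^sup>2 * snd h)) (at p)"
proof -
  let ?A = "A (fst p) (snd p)" and ?u = "u0 (snd p)" and ?u' = "u0' (snd p)"
  have "((\<lambda>p. u0 (snd p) / A (fst p) (snd p)) has_derivative
     (\<lambda>h. (?u' * snd h * ?A - ?u * (- k * ?u * fst h - k * ?u' * fst p * snd h)) / (?A * ?A))) (at p)"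
    using assms by (intro has_derivative_divide' has_derivative_u0_snd has_derivative_A) simp
  moreover have "?u' * snd h * ?A - ?u * (- k * ?u * fst h - k * ?u' * fst p * snd h)
      = k * ?u\<^sup>2 * fst h + ?u' * snd h" for h :: "real \<times> real"
    by (simp add: A_def algebra_simps power2_eq_square)
  ultimately show ?thesis
    unfolding W_def by (simp add: add_divide_distrib power_divide power2_eq_square)
qed

text \<open>Differentiating the logarithm gives the z part \<open>1 + u0' * t / A\<close>, and
  \<open>A + u0' * t\<close> is \<open>B\<close>.\<close>

lemma has_derivative_Y:
  assumes "A (fst p) (snd p) > 0"
  shows "((\<lambda>p. Y (fst p) (snd p)) has_derivative
     (\<lambda>h. W (fst p) (snd p) * fst h + B (fst p) (snd p) / A (fst p) (snd p) * snd h)) (at p)"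
proof -
  have "((\<lambda>p. snd p - ln (A (fst p) (snd p)) / k) has_derivative
     (\<lambda>h. snd h - (- k * u0 (snd p) * fst h - k * u0' (snd p) * fst p * snd h)
        / A (fst p) (snd p) / k)) (at p)"
    using assms k_pos
    by (auto intro!: derivative_eq_intros has_derivative_A simp: divide_inverse mult.commute)
  moreover have "(\<lambda>h. snd h - (- k * u0 (snd p) * fst h - k * u0' (snd p) * fst p * snd h)
        / A (fst p) (snd p) / k) =
     (\<lambda>h. W (fst p) (snd p) * fst h + B (fst p) (snd p) / A (fst p) (snd p) * snd h)"
    using assms k_pos
    by (auto simp: fun_eq_iff W_def divide_simps) (simp add: A_def B_def algebra_simps)
  ultimately show ?thesis
    unfolding Y_def by simp
qed

lemma deriv_Y_t:
  assumes "A t z > 0"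
  shows "((\<lambda>t. Y t z) has_real_derivative W t z) (at t within S)"
  unfolding has_field_derivative_def
  by (rule has_derivative_at_withinI, rule has_derivative_eq_rhs,
      rule has_derivative_compose[of "\<lambda>t. (t, z)" "\<lambda>h. (h, 0)" t UNIV, OF _ has_derivative_Y, simplified])
    (use assms in \<open>auto intro!: derivative_eq_intros\<close>)

lemma deriv_Y_z:
  assumes "A t z > 0"
  shows "((\<lambda>z. Y t z) has_real_derivative B t z / A t z) (at z)"
  unfolding has_field_derivative_def
  by (rule has_derivative_eq_rhs,
      rule has_derivative_compose[of "\<lambda>z. (t, z)" "\<lambda>h. (0, h)" z UNIV, OF _ has_derivative_Y, simplified])
    (use assms in \<open>auto intro!: derivative_eq_intros\<close>)

lemma deriv_W_t:
  assumes "A t z > 0"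
  shows "((\<lambda>t. W t z) has_real_derivative k * (W t z)\<^sup>2) (at t within S)"
  unfolding has_field_derivative_def
  by (rule has_derivative_at_withinI, rule has_derivative_eq_rhs,
      rule has_derivative_compose[of "\<lambda>t. (t, z)" "\<lambda>h. (h, 0)" t UNIV, OF _ has_derivative_W, simplified])
    (use assms in \<open>auto intro!: derivative_eq_intros\<close>)

lemma deriv_W_z:
  assumes "A t z > 0"
  shows "((\<lambda>z. W t z) has_real_derivative u0' z / (A t z)\<^sup>2) (at z)"
  unfolding has_field_derivative_def
  by (rule has_derivative_eq_rhs,
      rule has_derivative_compose[of "\<lambda>z. (t, z)" "\<lambda>h. (0, h)" z UNIV, OF _ has_derivative_W, simplified])
    (use assms in \<open>auto intro!: derivative_eq_intros\<close>)

end

section \<open>Uniqueness: any classical solution agrees with the explicit formulas\<close>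

lemma continuous_on_classical_solution:
  assumes "classical_solution k u0 D u"
  shows "continuous_on D (\<lambda>(t, x). u t x)"
proof -
  obtain ut ux where
    "\<And>t x. (t, x) \<in> D \<Longrightarrow>
       ((\<lambda>(t, x). u t x) has_derivative (\<lambda>(\<tau>, \<xi>). ut t x * \<tau> + ux t x * \<xi>))
         (at (t, x) within {0..} \<times> UNIV)"
    using assms by (rule classical_solutionE) blast
  moreover have "D \<subseteq> {0..} \<times> UNIV"
    using assms by (auto simp: classical_solution_def openin_open)
  ultimately show ?thesis
    unfolding continuous_on_eq_continuous_within
    by (auto intro: continuous_within_subset dest!: has_derivative_continuous)
qed

context burgers_datum
begin

text \<open>\<open>Y\<close> moves with speed \<open>W\<close> rather than \<open>u\<close>, so by
  the equation the derivative of \<open>u\<close> along it is \<open>k * u^2 - ux * (u - W)\<close>.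
  Subtracting \<open>k * W^2\<close>, the derivative of \<open>W\<close>, leaves a multiple of
  \<open>u - W\<close>, which starts at 0.\<close>

lemma solution_along_Y:
  assumes sol: "classical_solution k u0 D u"
    and curve: "\<And>s. s \<in> {0..t} \<Longrightarrow> (s, Y s z) \<in> D" "\<And>s. s \<in> {0..t} \<Longrightarrow> A s z > 0"
    and s: "s \<in> {0..t}"
  shows "u s (Y s z) = W s z"
proof -
  obtain ut ux where cux: "continuous_on D (\<lambda>(t, x). ux t x)"
    and du: "\<And>t x. (t, x) \<in> D \<Longrightarrow>
       ((\<lambda>(t, x). u t x) has_derivative (\<lambda>(\<tau>, \<xi>). ut t x * \<tau> + ux t x * \<xi>))
         (at (t, x) within {0..} \<times> UNIV)"
    and pde: "\<And>t x. (t, x) \<in> D \<Longrightarrow> ut t x + u t x * ux t x = k * (u t x)\<^sup>2"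
    using sol by (rule classical_solutionE) blast
  have cY: "continuous_on {0..t} (\<lambda>s. (s, Y s z))"
    using curve(2) by (intro continuous_intros) auto
  have img: "(\<lambda>s. (s, Y s z)) ` {0..t} \<subseteq> D"
    using curve(1) by auto
  have cont_u: "continuous_on {0..t} (\<lambda>s. u s (Y s z))"
    using continuous_on_compose2[OF continuous_on_classical_solution[OF sol] cY img] by simp
  have cont_ux: "continuous_on {0..t} (\<lambda>s. ux s (Y s z))"
    using continuous_on_compose2[OF cux cY img] by simp
  have cont_W: "continuous_on {0..t} (\<lambda>s. W s z)"
    using curve(2) by (intro continuous_intros) auto
  have initial: "u 0 (Y 0 z) - W 0 z = 0"
    using sol by (simp add: classical_solution_def Y_def W_def A_def)
  have "u s (Y s z) - W s z = 0"
  proof (rule linear_ode_zero[where t = t and s = s and e = "\<lambda>s. u s (Y s z) - W s z"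
        and g = "\<lambda>s. k * (u s (Y s z) + W s z) - ux s (Y s z)"])
    fix s assume s: "s \<in> {0..t}"
    have "((\<lambda>s. u s (Y s z)) has_real_derivative ut s (Y s z) + ux s (Y s z) * W s z)
        (at s within {0..t})"
      by (rule has_derivative_along_curve[OF du deriv_Y_t]) (use s curve in auto)
    then have "((\<lambda>s. u s (Y s z) - W s z) has_real_derivative
        (ut s (Y s z) + ux s (Y s z) * W s z) - k * (W s z)\<^sup>2) (at s within {0..t})"
      by (intro DERIV_diff deriv_W_t curve(2) s)
    moreover have "ut s (Y s z) = k * (u s (Y s z))\<^sup>2 - u s (Y s z) * ux s (Y s z)"
      using pde[OF curve(1)[OF s]] by simp
    ultimately show "((\<lambda>s. u s (Y s z) - W s z) has_real_derivative
        (k * (u s (Y s z) + W s z) - ux s (Y s z)) * (u s (Y s z) - W s z)) (at s within {0..t})"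
      by (simp add: algebra_simps power2_eq_square)
  qed (use s initial in \<open>auto intro!: continuous_intros cont_u cont_ux cont_W\<close>)
  then show ?thesis by simp
qed

text \<open>Along \<open>X\<close> the speed is \<open>u\<close> itself, so \<open>ux\<close>
  cancels and \<open>u - W\<close> solves a linear equation with coefficient
  \<open>k * (u + W)\<close>. Once \<open>u = W\<close> there, \<open>X\<close> and \<open>Y\<close>
  have equal velocity and equal starting point.\<close>

lemma characteristic_eq_Y:
  assumes sol: "classical_solution k u0 D u"
    and ch: "characteristic D u {0..<T} z X"
    and A: "\<And>s. s \<in> {0..<T} \<Longrightarrow> A s z > 0" and t: "t \<in> {0..<T}"
  shows "X t = Y t z"
proof -
  have sub: "{0..t} \<subseteq> {0..<T}"
    using t by auto
  have X: "(s, X s) \<in> D" "(X has_real_derivative u s (X s)) (at s within {0..t})"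
    if "s \<in> {0..t}" for s
  proof -
    have "s \<in> {0..<T}"
      using that sub by blast
    then show "(s, X s) \<in> D" "(X has_real_derivative u s (X s)) (at s within {0..t})"
      using ch DERIV_subset[OF _ sub] unfolding characteristic_def by auto
  qed
  have X0: "X 0 = z"
    using ch by (simp add: characteristic_def)
  obtain ut ux where
    du: "\<And>t x. (t, x) \<in> D \<Longrightarrow>
       ((\<lambda>(t, x). u t x) has_derivative (\<lambda>(\<tau>, \<xi>). ut t x * \<tau> + ux t x * \<xi>))
         (at (t, x) within {0..} \<times> UNIV)"
    and pde: "\<And>t x. (t, x) \<in> D \<Longrightarrow> ut t x + u t x * ux t x = k * (u t x)\<^sup>2"
    using sol by (rule classical_solutionE) blast
  have cX: "continuous_on {0..t} (\<lambda>s. (s, X s))"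
    by (intro continuous_intros DERIV_continuous_on[OF X(2)])
  have img: "(\<lambda>s. (s, X s)) ` {0..t} \<subseteq> D"
    using X(1) by auto
  have cont_u: "continuous_on {0..t} (\<lambda>s. u s (X s))"
    using continuous_on_compose2[OF continuous_on_classical_solution[OF sol] cX img] by simp
  have cont_W: "continuous_on {0..t} (\<lambda>s. W s z)"
    using A sub by (intro continuous_intros) auto
  have initial: "u 0 (X 0) - W 0 z = 0"
    using sol X0 by (simp add: classical_solution_def W_def A_def)
  have u_eq_W: "u s (X s) - W s z = 0" if "s \<in> {0..t}" for s
  proof (rule linear_ode_zero[where t = t and s = s and e = "\<lambda>s. u s (X s) - W s z"
        and g = "\<lambda>s. k * (u s (X s) + W s z)"])
    fix s assume s: "s \<in> {0..t}"
    have "((\<lambda>s. u s (X s)) has_real_derivative ut s (X s) + ux s (X s) * u s (X s))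
        (at s within {0..t})"
      by (rule has_derivative_along_curve[OF du X(2)]) (use s X in auto)
    then have "((\<lambda>s. u s (X s) - W s z) has_real_derivative
        (ut s (X s) + ux s (X s) * u s (X s)) - k * (W s z)\<^sup>2) (at s within {0..t})"
      using s sub by (intro DERIV_diff deriv_W_t A) auto
    moreover have "ut s (X s) = k * (u s (X s))\<^sup>2 - u s (X s) * ux s (X s)"
      using pde[OF X(1)[OF s]] by simp
    ultimately show "((\<lambda>s. u s (X s) - W s z) has_real_derivative
        (k * (u s (X s) + W s z)) * (u s (X s) - W s z)) (at s within {0..t})"
      by (simp add: algebra_simps power2_eq_square)
  qed (use that initial in \<open>auto intro!: continuous_intros cont_u cont_W\<close>)
  have "X t - Y t z = 0"
  proof (rule linear_ode_zero[where t = t and s = t and e = "\<lambda>s. X s - Y s z" and g = "\<lambda>_. 0"])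
    fix s assume s: "s \<in> {0..t}"
    then have "((\<lambda>s. X s - Y s z) has_real_derivative u s (X s) - W s z) (at s within {0..t})"
      using sub by (intro DERIV_diff X deriv_Y_t A) auto
    then show "((\<lambda>s. X s - Y s z) has_real_derivative 0 * (X s - Y s z)) (at s within {0..t})"
      using u_eq_W[OF s] by simp
  qed (use X0 t in \<open>auto simp: Y_def A_def\<close>)
  then show ?thesis by simp
qed

text \<open>If the curve from \<open>z\<close> stays in \<open>D\<close> on the compact interval up
  to \<open>t\<close>, so do the curves from all nearby \<open>y\<close>. Hence
  \<open>u t (Y t y) = W t y\<close> near \<open>z\<close>, and both sides can be differentiated in
  \<open>y\<close>.\<close>

lemma deriv_solution_along_Y:
  assumes sol: "classical_solution k u0 D u" and "t \<ge> 0"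
    and curve: "\<And>s. s \<in> {0..t} \<Longrightarrow> (s, Y s z) \<in> D" "\<And>s. s \<in> {0..t} \<Longrightarrow> A s z > 0"
    and B: "B t z > 0"
  shows "deriv (u t) (Y t z) = u0' z / (A t z * B t z)"
proof -
  obtain ux where ux: "\<And>t x. (t, x) \<in> D \<Longrightarrow> (u t has_real_derivative ux t x) (at x)"
    using sol by (rule classical_solutionE) blast
  obtain U where U: "open U" "D = ({0..} \<times> UNIV) \<inter> U"
    using sol by (auto simp: classical_solution_def openin_open)
  \<comment> \<open>Pairs are in the order (z, t) here, because the tube lemma thickens the first
    factor of a point times a compact set.\<close>
  define V where "V = {p. 0 < A (snd p) (fst p)}"
  have V: "open V"
    unfolding V_def by (intro open_Collect_less continuous_intros)
  have opn: "open (V \<inter> (\<lambda>p. (snd p, Y (snd p) (fst p))) -` U)"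
    by (rule continuous_open_preimage[OF _ V U(1)]) (auto simp: V_def intro!: continuous_intros)
  have sub: "{z} \<times> {0..t} \<subseteq> V \<inter> (\<lambda>p. (snd p, Y (snd p) (fst p))) -` U"
    using curve U by (auto simp: V_def)
  from Elementary_Topology.tube_lemma[OF compact_Icc opn sub]
  obtain N where N: "z \<in> N" "open N"
    "N \<times> {0..t} \<subseteq> V \<inter> (\<lambda>p. (snd p, Y (snd p) (fst p))) -` U"
    by blast
  have u_W: "u t (Y t y) = W t y" if "y \<in> N" for y
  proof -
    have "(y, s) \<in> V \<inter> (\<lambda>p. (snd p, Y (snd p) (fst p))) -` U" if "s \<in> {0..t}" for s
      using \<open>y \<in> N\<close> that N(3) by blast
    then show ?thesis
      using \<open>t \<ge> 0\<close> by (intro solution_along_Y[OF sol, of t]) (auto simp: U V_def)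
  qed
  have At: "A t z > 0" and Dt: "(t, Y t z) \<in> D"
    using curve \<open>t \<ge> 0\<close> by auto
  have "((\<lambda>y. u t (Y t y)) has_real_derivative ux t (Y t z) * (B t z / A t z)) (at z)"
    using DERIV_chain2[OF ux[OF Dt] deriv_Y_z[OF At]] .
  moreover have "((\<lambda>y. u t (Y t y)) has_real_derivative u0' z / (A t z)\<^sup>2) (at z)"
    by (rule has_field_derivative_transform_within_open[OF deriv_W_z[OF At] N(2,1)]) (simp add: u_W)
  ultimately have "ux t (Y t z) * (B t z / A t z) = u0' z / (A t z)\<^sup>2"
    by (rule DERIV_unique)
  then have "ux t (Y t z) = u0' z / (A t z * B t z)"
    using At B by (simp add: field_simps power2_eq_square)
  with DERIV_imp_deriv[OF ux[OF Dt]] show ?thesis by simp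
qed

section \<open>Existence: inverting the flow map\<close>

text \<open>
  The slices of Omega at fixed time are intervals, which makes the global injectivity of Phi a
  matter of monotonicity in z.  Negative times are admitted so that Omega is open in the plane and
  the inverse function theorem applies up to time 0.
\<close>

definition Omega :: "real \<Rightarrow> (real \<times> real) set" where
  "Omega c = {p. \<forall>s\<in>{0..1}. 0 < A (fst p) (c + s * (snd p - c)) \<and> 0 < B (fst p) (c + s * (snd p - c))}"

definition Phi :: "real \<times> real \<Rightarrow> real \<times> real" where
  "Phi p = (fst p, Y (fst p) (snd p))"

text \<open>The positivity conditions are open in point and segment parameter together; since the
  parameter ranges over a compact interval, the tube lemma makes them hold on a whole neighbourhood
  of the point.\<close>

lemma open_Omega: "open (Omega c)"
proof -
  define V where "V = {q :: (real \<times> real) \<times> real.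
     0 < A (fst (fst q)) (c + snd q * (snd (fst q) - c)) \<and> 0 < B (fst (fst q)) (c + snd q * (snd (fst q) - c))}"
  have V: "open V"
    unfolding V_def by (intro open_Collect_conj open_Collect_less continuous_intros)
  have "\<exists>N. open N \<and> p \<in> N \<and> N \<subseteq> Omega c" if "p \<in> Omega c" for p
  proof -
    have "{p} \<times> {0..1} \<subseteq> V"
      using that by (auto simp: V_def Omega_def)
    from Elementary_Topology.tube_lemma[OF compact_Icc V this]
    obtain N where "p \<in> N" "open N" "N \<times> {0..1} \<subseteq> V"
      by blast
    then show ?thesis
      by (intro exI[of _ N]) (auto simp: V_def Omega_def)
  qed
  then show ?thesis
    using open_subopen[of "Omega c"] by blast
qed

lemma OmegaD: "(t, z) \<in> Omega c \<Longrightarrow> A t z > 0" "(t, z) \<in> Omega c \<Longrightarrow> B t z > 0"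
  by (auto simp: Omega_def dest: bspec[of _ _ 1])

text \<open>Each time slice is star-shaped about \<open>c\<close>, which on the line means an
  interval.\<close>

lemma Omega_interval:
  assumes "(t, a) \<in> Omega c" "(t, b) \<in> Omega c" "a \<le> x" "x \<le> b"
  shows "(t, x) \<in> Omega c"
proof -
  have star: "(t, x) \<in> Omega c" if "(t, y) \<in> Omega c" "x = c + r * (y - c)" "r \<in> {0..1}" for x y r
    unfolding Omega_def
  proof (clarsimp)
    fix s :: real assume s: "0 \<le> s" "s \<le> 1"
    have "s * r \<in> {0..1}"
      using s that(3) by (auto intro: mult_le_one)
    moreover have "c + s * (x - c) = c + (s * r) * (y - c)"
      using that(2) by simp
    ultimately show "0 < A t (c + s * (x - c)) \<and> 0 < B t (c + s * (x - c))"
      using that(1) unfolding Omega_def by (metis (no_types, lifting) fst_conv mem_Collect_eq snd_conv)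
  qed
  show ?thesis
  proof (cases "x \<le> c")
    case True
    show ?thesis
      \<comment> \<open>When \<open>a = c\<close> the point \<open>x\<close> is squeezed to
        \<open>c\<close>, and the ratio 0 serves.\<close>
      by (rule star[OF assms(1), of _ "if a = c then 0 else (x - c) / (a - c)"])
        (use True assms in \<open>auto simp: divide_simps\<close>)
  next
    case False
    show ?thesis
      by (rule star[OF assms(2), of _ "if b = c then 0 else (x - c) / (b - c)"])
        (use False assms in \<open>auto simp: divide_simps\<close>)
  qed
qed

text \<open>\<open>Phi\<close> preserves time, and on a slice the derivative \<open>B / A\<close> is
  positive throughout the interval between two points, so \<open>Y\<close> is strictly increasing
  there.\<close>

lemma inj_on_Phi: "inj_on Phi (Omega c)"
proof -
  have less: "Y t a < Y t b" if "(t, a) \<in> Omega c" "(t, b) \<in> Omega c" "a < b" for t a b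
  proof (rule DERIV_pos_imp_increasing[OF \<open>a < b\<close>])
    fix x assume "a \<le> x" "x \<le> b"
    then have "(t, x) \<in> Omega c"
      using Omega_interval that by blast
    then show "\<exists>y. ((\<lambda>z. Y t z) has_real_derivative y) (at x) \<and> 0 < y"
      using deriv_Y_z OmegaD by (metis divide_pos_pos)
  qed
  show ?thesis
  proof (rule inj_onI)
    fix p q assume p: "p \<in> Omega c" and q: "q \<in> Omega c" and eq: "Phi p = Phi q"
    obtain t a b where "p = (t, a)" "q = (t, b)" "Y t a = Y t b"
      using eq by (cases p, cases q) (auto simp: Phi_def)
    then show "p = q"
      using less[of t a b] less[of t b a] p q by (cases a b rule: linorder_cases) auto
  qed
qed

lemma has_derivative_Phi:
  assumes "(t, z) \<in> Omega c"
  shows "(Phi has_derivative (\<lambda>h. (fst h, W t z * fst h + B t z / A t z * snd h))) (at (t, z))"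
proof -
  have "((\<lambda>p. (fst p, Y (fst p) (snd p))) has_derivative
      (\<lambda>h. (fst h, W t z * fst h + B t z / A t z * snd h))) (at (t, z))"
    using has_derivative_Y[of "(t, z)"] OmegaD[OF assms]
    by (auto intro!: has_derivative_Pair derivative_eq_intros)
  then show ?thesis
    by (simp add: Phi_def[abs_def])
qed

lemma solution_exists_on_characteristic:
  assumes "J \<subseteq> {0..}" and pos: "\<And>t. t \<in> J \<Longrightarrow> A t c > 0" "\<And>t. t \<in> J \<Longrightarrow> B t c > 0"
  shows "\<exists>D u X. classical_solution k u0 D u \<and> characteristic D u J c X"
proof -
  define G where "G = inv_into (Omega c) Phi"
  have GPhi: "G (Phi p) = p" if "p \<in> Omega c" for p
    unfolding G_def using inj_on_Phi that by (rule inv_into_f_f)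
  have contPhi: "continuous_on (Omega c) Phi"
    unfolding Phi_def by (intro continuous_intros) (auto simp: OmegaD)
  \<comment> \<open>Invariance of domain makes the image of a continuous injection open, so that
    \<open>D\<close> is relatively open.\<close>
  have opn: "open (Phi ` Omega c)"
    by (rule invariance_of_domain[OF contPhi open_Omega inj_on_Phi])
  have contG: "continuous_on (Phi ` Omega c) G"
    unfolding G_def by (rule continuous_on_inverse_open[OF open_Omega contPhi]) (auto simp: inj_on_Phi)
  define D where "D = ({0..} \<times> UNIV) \<inter> Phi ` Omega c"
  define w where "w t x = W (fst (G (t, x))) (snd (G (t, x)))" for t x
  define wx where "wx t x = u0' (snd (G (t, x))) /
    (A (fst (G (t, x))) (snd (G (t, x))) * B (fst (G (t, x))) (snd (G (t, x))))" for t x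
  \<comment> \<open>The equation holds by this choice; what remains is that \<open>wt\<close> is the
    time derivative, shown in \<open>dw\<close>.\<close>
  define wt where "wt t x = k * (w t x)\<^sup>2 - w t x * wx t x" for t x
  have GD: "continuous_on D (\<lambda>p. G p)" "\<And>p. p \<in> D \<Longrightarrow> G p \<in> Omega c"
    using continuous_on_subset[OF contG] GPhi by (auto simp: D_def)
  have GpD: "A (fst (G p)) (snd (G p)) > 0" "B (fst (G p)) (snd (G p)) > 0" if "p \<in> D" for p
    using OmegaD[of "fst (G p)" "snd (G p)" c] GD(2)[OF that] by auto
  have w: "w t (Y t z) = W t z" "G (t, Y t z) = (t, z)" "(t, Y t z) \<in> Phi ` Omega c"
    if "(t, z) \<in> Omega c" for t z
    using GPhi[OF that] imageI[OF that, of Phi] by (auto simp: w_def Phi_def)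
  \<comment> \<open>At time 0 both \<open>A\<close> and \<open>B\<close> equal 1, so the whole
    initial line is included.\<close>
  have in0: "(0, z) \<in> Omega c" and Y0: "Y 0 z = z" and W0: "W 0 z = u0 z" for z
    by (auto simp: Omega_def A_def B_def Y_def W_def)
  have dw: "((\<lambda>p. w (fst p) (snd p)) has_derivative (\<lambda>h. wt t x * fst h + wx t x * snd h)) (at (t, x))"
    if "(t, x) \<in> D" for t x
  proof -
    have "(t, x) \<in> Phi ` Omega c"
      using that by (simp add: D_def)
    then obtain p where p: "(t, x) = Phi p" "p \<in> Omega c"
      by (rule imageE)
    define z where "z = snd p"
    have "p = (t, z)"
      using p(1) by (simp add: Phi_def z_def prod_eq_iff)
    with p have z: "(t, z) \<in> Omega c" "x = Y t z"
      by (simp_all add: Phi_def)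
    have AB: "A t z > 0" "B t z > 0"
      using OmegaD z by auto
    let ?Phi' = "\<lambda>h. (fst h, W t z * fst h + B t z / A t z * snd h)"
    \<comment> \<open>The inverse of the triangular map \<open>?Phi'\<close>.\<close>
    let ?G' = "\<lambda>h. (fst h, (snd h - W t z * fst h) * A t z / B t z)"
    have "?Phi' \<circ> ?G' = id"
      using AB by (auto simp: fun_eq_iff field_simps)
    from has_derivative_inverse_strong[OF open_Omega z(1) contPhi GPhi has_derivative_Phi[OF z(1)] this]
    have dG: "(G has_derivative ?G') (at (t, x))"
      using z(2) by (simp add: Phi_def)
    have dW: "((\<lambda>p. W (fst p) (snd p)) has_derivative
        (\<lambda>h. k * (W t z)\<^sup>2 * fst h + u0' z / (A t z)\<^sup>2 * snd h)) (at (G (t, x)))"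
      using has_derivative_W[of "(t, z)"] AB z w(2) by simp
    have "((\<lambda>p. w (fst p) (snd p)) has_derivative
        (\<lambda>h. k * (W t z)\<^sup>2 * fst h + u0' z / (A t z)\<^sup>2 * ((snd h - W t z * fst h) * A t z / B t z)))
        (at (t, x))"
      using has_derivative_compose[OF dG dW] by (simp add: w_def)
    moreover have eq: "wx t x = u0' z / (A t z * B t z)" "wt t x = k * (W t z)\<^sup>2 - W t z * wx t x"
      using w(1,2)[OF z(1)] z(2) by (simp_all add: wx_def wt_def)
    have "(\<lambda>h. k * (W t z)\<^sup>2 * fst h + u0' z / (A t z)\<^sup>2 * ((snd h - W t z * fst h) * A t z / B t z))
        = (\<lambda>h. wt t x * fst h + wx t x * snd h)"
      unfolding eq using AB by (auto simp: fun_eq_iff power2_eq_square field_simps)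
    ultimately show ?thesis by simp
  qed
  have "classical_solution k u0 D w"
    unfolding classical_solution_def
  proof (intro conjI exI)
    show "openin (top_of_set ({0..} \<times> UNIV)) D"
      unfolding D_def using opn by blast
    show "{0} \<times> UNIV \<subseteq> D"
      using w(3)[OF in0] Y0 by (auto simp: D_def)
    show "\<forall>x. w 0 x = u0 x"
      using w(1)[OF in0] Y0 W0 by simp
    have cw: "continuous_on D (\<lambda>p. w (fst p) (snd p))"
      unfolding w_def by (simp add: GD GpD continuous_intros)
    have cwx: "continuous_on D (\<lambda>p. wx (fst p) (snd p))"
      unfolding wx_def using GpD by (intro continuous_intros) (auto simp: GD less_imp_neq[symmetric])
    show "continuous_on D (\<lambda>(t, x). wt t x)"
      using cw cwx by (simp add: case_prod_unfold wt_def continuous_intros)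
    show "continuous_on D (\<lambda>(t, x). wx t x)"
      using cwx by (simp add: case_prod_unfold)
    have "((\<lambda>s. w s x) has_real_derivative wt t x) (at t within {0..}) \<and>
           ((\<lambda>y. w t y) has_real_derivative wx t x) (at x) \<and>
           wt t x + w t x * wx t x = k * (w t x)\<^sup>2"
      if tx: "(t, x) \<in> D" for t x
    proof -
      have line_t: "((\<lambda>s. (s, x)) has_derivative (\<lambda>h. (h, 0))) (at t within {0..})"
        and line_x: "((\<lambda>y. (t, y)) has_derivative (\<lambda>h. (0, h))) (at x)"
        by (auto intro!: derivative_eq_intros)
      have "((\<lambda>s. w s x) has_derivative (\<lambda>h. wt t x * h)) (at t within {0..})"
        using has_derivative_compose[OF line_t dw[OF tx]] by simp
      moreover have "((\<lambda>y. w t y) has_derivative (\<lambda>h. wx t x * h)) (at x)"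
        using has_derivative_compose[OF line_x dw[OF tx]] by simp
      ultimately show ?thesis
        by (simp add: has_field_derivative_def wt_def)
    qed
    then show "\<forall>(t, x)\<in>D.
           ((\<lambda>s. w s x) has_real_derivative wt t x) (at t within {0..}) \<and>
           ((\<lambda>y. w t y) has_real_derivative wx t x) (at x) \<and>
           wt t x + w t x * wx t x = k * (w t x)\<^sup>2"
      by blast
  qed
  moreover have "characteristic D w J c (\<lambda>t. Y t c)"
    unfolding characteristic_def
  proof (intro conjI ballI)
    fix t assume t: "t \<in> J"
    have in_Omega: "(t, c) \<in> Omega c"
      using pos[OF t] by (simp add: Omega_def)
    show "(t, Y t c) \<in> D"
      using w(3)[OF in_Omega] t \<open>J \<subseteq> {0..}\<close> by (auto simp: D_def)
    show "((\<lambda>t. Y t c) has_real_derivative w t (Y t c)) (at t within J)"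
      using deriv_Y_t[OF pos(1)[OF t]] w(1)[OF in_Omega] by simp
  qed (simp add: Y0)
  ultimately show ?thesis by blast
qed

section \<open>Criteria for blow-up and for global existence at a given starting point\<close>

text \<open>\<open>T\<close> is the zero of \<open>B\<close>. Since \<open>A = B - u0' * t\<close>
  with \<open>u0' < 0\<close>, \<open>A\<close> is still positive at \<open>T\<close>, so
  \<open>u0' / (A * B)\<close> diverges there while the solution exists at all earlier
  times.\<close>

lemma blows_up_on_characteristicI:
  assumes neg: "u0' c < 0" and gap: "u0' c < k * u0 c"
  shows "blows_up_on_characteristic k u0 c"
proof -
  define T where "T = 1 / (k * u0 c - u0' c)"
  have T: "T > 0"
    using gap by (simp add: T_def)
  have B_eq: "B t c = 1 - t / T" for t
    using gap by (simp add: B_def T_def field_simps)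
  have A_eq: "A t c = B t c - u0' c * t" for t
    by (simp add: A_def B_def algebra_simps)
  have B: "B t c > 0" if "t \<in> {0..<T}" for t
    using that T by (simp add: B_eq)
  have A: "A t c > 0" if "t \<in> {0..<T}" for t
    using B[OF that] that neg mult_nonpos_nonneg[of "u0' c" t] by (simp add: A_eq)
  have AT: "A T c > 0"
    using T neg by (simp add: A_eq B_eq mult_neg_pos)
  have ev: "\<forall>\<^sub>F t in at_left T. t \<in> {0..<T}"
    using eventually_at_left_real[OF T] by eventually_elim auto
  have "((\<lambda>t. A t c) \<longlongrightarrow> A T c) (at_left T)"
    unfolding A_def by (intro tendsto_intros)
  moreover have "((\<lambda>t. B t c) \<longlongrightarrow> B T c) (at_left T)"
    unfolding B_def by (intro tendsto_intros)
  then have "filterlim (\<lambda>t. inverse (B t c)) at_top (at_left T)"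
    using T ev by (intro filterlim_inverse_at_top) (auto simp: B_eq[of T] elim!: eventually_mono intro: B)
  ultimately have lim: "filterlim (\<lambda>t. - u0' c / A t c * inverse (B t c)) at_top (at_left T)"
    using AT neg
    by (intro filterlim_tendsto_pos_mult_at_top[where c = "- u0' c / A T c"]) (auto intro!: tendsto_intros simp: divide_neg_pos)
  have "blows_up_at (\<lambda>t. deriv (u t) (X t)) T"
    if sol: "classical_solution k u0 D u" and ch: "characteristic D u {0..<T} c X" for D u X
    unfolding blows_up_at_def
  proof (rule filterlim_mono_eventually[OF lim order_refl order_refl])
    show "\<forall>\<^sub>F t in at_left T. - u0' c / A t c * inverse (B t c) = \<bar>deriv (u t) (X t)\<bar>"
      using ev
    proof eventually_elim
      case (elim t)
      have X: "X s = Y s c" if "s \<in> {0..<T}" for s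
        by (rule characteristic_eq_Y[OF sol ch A that])
      have "(s, Y s c) \<in> D" if "s \<in> {0..t}" for s
      proof -
        have s: "s \<in> {0..<T}"
          using that elim by auto
        then have "(s, X s) \<in> D"
          using ch by (simp add: characteristic_def)
        then show ?thesis
          by (simp add: X[OF s])
      qed
      then have "deriv (u t) (X t) = u0' c / (A t c * B t c)"
        unfolding X[OF elim] using elim
        by (intro deriv_solution_along_Y[OF sol]) (auto intro: A B)
      then show ?case
        using A[OF elim] B[OF elim] neg by (simp add: abs_divide abs_mult divide_inverse)
    qed
  qed
  moreover have "\<exists>D u X. classical_solution k u0 D u \<and> characteristic D u {0..<T} c X"
    by (rule solution_exists_on_characteristic) (auto intro: A B)
  ultimately show ?thesis
    unfolding blows_up_on_characteristic_def using T by blast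
qed

text \<open>The two sign conditions keep \<open>A\<close> and \<open>B\<close> at least 1 for all
  nonnegative times.\<close>

lemma exists_globally_on_characteristicI:
  assumes "u0 c \<le> 0" "k * u0 c \<le> u0' c"
  shows "exists_globally_on_characteristic k u0 c"
  unfolding exists_globally_on_characteristic_def
proof (rule solution_exists_on_characteristic)
  fix t :: real assume "t \<in> {0..}"
  then have "k * u0 c * t \<le> 0" "(u0' c - k * u0 c) * t \<ge> 0"
    using assms k_pos by (auto simp: mult_nonneg_nonpos mult_nonpos_nonneg)
  then show "A t c > 0" "B t c > 0"
    by (simp_all add: A_def B_def)
qed auto

end

section \<open>Short supports\<close>

text \<open>The set where \<open>u0\<close> is nonzero is open, so it lies in the interior of the
  interval. The resulting zeros at the endpoints anchor the mean value arguments.\<close>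

lemma initial_datumE:
  assumes "k > 0" "initial_datum \<alpha> \<beta> u0"
  shows "burgers_datum k u0 (deriv u0)" "\<And>x. x \<notin> {\<alpha><..<\<beta>} \<Longrightarrow> u0 x = 0" "\<exists>x. u0 x \<noteq> 0"
proof -
  obtain v where v: "\<And>x. (u0 has_real_derivative v x) (at x)" "continuous_on UNIV v"
    using assms(2)
    by (auto simp: initial_datum_def C1_differentiable_on_def has_real_derivative_iff_has_vector_derivative)
  have "deriv u0 = v"
    using v(1) DERIV_imp_deriv by blast
  with v \<open>k > 0\<close> show "burgers_datum k u0 (deriv u0)"
    by unfold_locales auto
  then have "continuous_on UNIV u0"
    by (rule burgers_datum.cont_u0)
  then have "open {x. u0 x \<noteq> 0}"
    by (intro open_Collect_neq) auto
  moreover have "{x. u0 x \<noteq> 0} \<subseteq> {\<alpha>..\<beta>}"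
    by (rule order_trans[OF closure_subset]) (use assms(2) in \<open>simp add: initial_datum_def\<close>)
  ultimately have "{x. u0 x \<noteq> 0} \<subseteq> interior {\<alpha>..\<beta>}"
    by (intro interior_maximal)
  then show "\<And>x. x \<notin> {\<alpha><..<\<beta>} \<Longrightarrow> u0 x = 0"
    by auto
  show "\<exists>x. u0 x \<noteq> 0"
    using assms(2) by (simp add: initial_datum_def)
qed

lemma blows_up_if_support_short:
  assumes "k > 0" "\<beta> - \<alpha> \<le> 1 / k" "initial_datum \<alpha> \<beta> u0" "global_min_point (deriv u0) c"
  shows "blows_up_on_characteristic k u0 c"
proof -
  interpret burgers_datum k u0 "deriv u0"
    using assms by (intro initial_datumE)
  note zero = initial_datumE(2)[OF assms(1,3)]
  have min: "deriv u0 c \<le> deriv u0 x" for x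
    using assms(4) by (simp add: global_min_point_def)
  have mvt: "\<exists>y>a. u0 b - u0 a = (b - a) * deriv u0 y" if "a < b" for a b
    using MVT2[OF that deriv_u0] by blast
  obtain x where x: "u0 x \<noteq> 0"
    using initial_datumE(3)[OF assms(1,3)] by blast
  have x_in: "\<alpha> < x" "x < \<beta>" and ends: "u0 \<alpha> = 0" "u0 \<beta> = 0"
    using zero[of x] zero[of \<alpha>] zero[of \<beta>] x by auto
  obtain y1 y2 where y: "u0 x = (x - \<alpha>) * deriv u0 y1" "- u0 x = (\<beta> - x) * deriv u0 y2"
    using mvt[of \<alpha> x] mvt[of x \<beta>] x_in ends by auto
  \<comment> \<open>A nonzero value cannot be reached from 0 and left back to 0 with nonnegative
    slopes only.\<close>
  have neg: "deriv u0 c < 0"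
  proof (rule ccontr)
    assume "\<not> deriv u0 c < 0"
    then have "deriv u0 y1 \<ge> 0" "deriv u0 y2 \<ge> 0"
      using min[of y1] min[of y2] by linarith+
    then have "(x - \<alpha>) * deriv u0 y1 \<ge> 0" "(\<beta> - x) * deriv u0 y2 \<ge> 0"
      using x_in by simp_all
    then have "u0 x \<ge> 0" "- u0 x \<ge> 0"
      using y by linarith+
    with x show False by simp
  qed
  have "deriv u0 c < k * u0 c"
  proof (rule ccontr)
    assume "\<not> deriv u0 c < k * u0 c"
    then have le: "k * u0 c \<le> deriv u0 c" by simp
    then have "u0 c \<noteq> 0"
      using neg by auto
    then have c: "\<alpha> < c" "c < \<beta>"
      using zero[of c] by auto
    then obtain y where "u0 c = (c - \<alpha>) * deriv u0 y"
      using mvt[of \<alpha> c] ends by auto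
    then have "(c - \<alpha>) * deriv u0 c \<le> u0 c"
      using min[of y] c by simp
    then have "k * ((c - \<alpha>) * deriv u0 c) \<le> deriv u0 c"
      using \<open>k > 0\<close> le by (meson mult_left_mono order_trans less_imp_le)
    then have "(k * (c - \<alpha>) - 1) * deriv u0 c \<le> 0"
      by (simp add: algebra_simps)
    then have "k * (c - \<alpha>) \<ge> 1"
      using neg by (simp add: mult_le_0_iff)
    \<comment> \<open>The strict inequality \<open>c < \<beta>\<close> covers the borderline length
      1/k.\<close>
    moreover have "k * (c - \<alpha>) < k * (\<beta> - \<alpha>)" "k * (\<beta> - \<alpha>) \<le> 1"
      using c assms(1,2) by (auto simp: field_simps)
    ultimately show False by simp
  qed
  with neg show ?thesis
    by (rule blows_up_on_characteristicI)
qed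

section \<open>Long supports\<close>

text \<open>
  With y = x - \<alpha>, the profile is - y^2 / (y + e) up to the point c, its steepest, and then the cubic
  that matches value and slope at c and vanishes to second order at \<beta>.
\<close>

lemma late_minimum_profile:
  fixes k \<alpha> \<beta> :: real
  assumes k: "k > 0" and long: "\<beta> - \<alpha> > 1 / k"
  obtains v v' c where
    "\<And>x. (v has_real_derivative v' x) (at x)" "continuous_on UNIV v'"
    "\<And>x. x \<notin> {\<alpha>..\<beta>} \<Longrightarrow> v x = 0" "v c < 0" "\<And>x. x \<noteq> c \<Longrightarrow> v' c < v' x" "k * v c \<le> v' c"
proof -
  \<comment> \<open>Half of the excess length over 1/k lengthens the descent, the other half is left
    for the return to 0.\<close>
  define e where "e = (\<beta> - \<alpha> - 1 / k) / 2"
  define l where "l = 1 / k + e"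
  define c where "c = \<alpha> + l"
  define h where "h = l\<^sup>2 / (l + e)"
  define m where "m = l * (l + 2 * e) / (l + e)\<^sup>2"
  \<comment> \<open>\<open>P\<close> and \<open>Q\<close> solve the two linear conditions that
    \<open>g\<close> has value \<open>- h\<close> and slope \<open>- m\<close> at
    \<open>c\<close>.\<close>
  define P where "P = - (m + 3 * h / e) / e"
  define Q where "Q = (m + 2 * h / e) / e\<^sup>2"
  have e: "e > 0" and l: "l > 0" and \<beta>: "\<beta> = c + e"
    using long k by (simp_all add: e_def l_def c_def add_pos_pos field_simps)
  have h: "h > 0" and m: "m > 0"
    using e l by (simp_all add: h_def m_def)
  define f where "f x = - ((x - \<alpha>)\<^sup>2 / (x - \<alpha> + e))" for x
  define f' where "f' x = - ((x - \<alpha>) * (x - \<alpha> + 2 * e) / (x - \<alpha> + e)\<^sup>2)" for x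
  define g where "g x = (\<beta> - x)\<^sup>2 * (P + Q * (\<beta> - x))" for x
  define g' where "g' x = - (2 * P * (\<beta> - x) + 3 * Q * (\<beta> - x)\<^sup>2)" for x
  \<comment> \<open>With the test at \<open>\<alpha>\<close> innermost, gluing asks for the
    derivative of \<open>f\<close> only from \<open>\<alpha>\<close> on, away from its pole at
    \<open>\<alpha> - e\<close>.\<close>
  define v where "v x = (if x \<le> \<beta> then if x \<le> c then if x \<le> \<alpha> then 0 else f x else g x else 0)" for x
  define v' where "v' x = (if x \<le> \<beta> then if x \<le> c then if x \<le> \<alpha> then 0 else f' x else g' x else 0)" for x
  have f: "(f has_real_derivative f' x) (at x)" if "x \<ge> \<alpha>" for x
    using that e unfolding f_def[abs_def] f'_def
    by (auto intro!: derivative_eq_intros simp: field_simps power2_eq_square)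
  have g: "(g has_real_derivative g' x) (at x)" for x
    unfolding g_def[abs_def] g'_def
    by (auto intro!: derivative_eq_intros simp: algebra_simps power2_eq_square)
  have "f c = - h" "f' c = - m"
    by (simp_all add: f_def f'_def h_def m_def c_def)
  moreover have "g c = - h" "g' c = - m"
    using e by (simp_all add: g_def g'_def P_def Q_def \<beta> field_simps power2_eq_square)
  ultimately have at_c: "f c = - h" "g c = - h" "f' c = - m" "g' c = - m"
    by simp_all
  have at_ends: "f \<alpha> = 0" "f' \<alpha> = 0" "g \<beta> = 0" "g' \<beta> = 0"
    by (simp_all add: f_def f'_def g_def g'_def)
  have ord: "\<alpha> < c" "c < \<beta>"
    using e l by (simp_all add: c_def \<beta>)
  show ?thesis
  proof (rule that[of v v' c])
    show "(v has_real_derivative v' x) (at x)" for x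
      unfolding v_def[abs_def] v'_def
      by (intro DERIV_paste) (use f g at_c at_ends ord in auto)
    show "continuous_on UNIV v'"
      unfolding v'_def[abs_def]
    proof (intro continuous_on_paste continuous_on_subset[OF continuous_on_paste])
      show "continuous_on {\<alpha>..} f'"
        unfolding f'_def using e by (intro continuous_intros) auto
      show "continuous_on {c..} g'"
        unfolding g'_def by (intro continuous_intros)
    qed (use at_c at_ends ord in auto)
    show "v x = 0" if "x \<notin> {\<alpha>..\<beta>}" for x
      using that ord by (auto simp: v_def)
    show "v c < 0"
      using h ord at_c by (simp add: v_def)
    have "v' c = - m"
      using ord at_c by (simp add: v'_def)
    moreover have "f' x > - m" if "\<alpha> \<le> x" "x < c" for x
    proof -
      \<comment> \<open>In this form the steepness visibly increases with \<open>y\<close>, so it is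
        greatest at \<open>c\<close>.\<close>
      have *: "y * (y + 2 * e) / (y + e)\<^sup>2 = 1 - e\<^sup>2 / (y + e)\<^sup>2" if "y \<ge> 0" for y
      proof -
        have "y * (y + 2 * e) = (y + e)\<^sup>2 - e\<^sup>2"
          by (simp add: power2_eq_square algebra_simps)
        then show ?thesis
          using that e by (simp add: diff_divide_distrib)
      qed
      have "e\<^sup>2 / (l + e)\<^sup>2 < e\<^sup>2 / (x - \<alpha> + e)\<^sup>2"
        using that e l by (intro divide_strict_left_mono power_strict_mono) (auto simp: c_def)
      then show ?thesis
        using *[of l] *[of "x - \<alpha>"] that l by (simp add: f'_def m_def)
    qed
    moreover have "g' x > - m" if "c < x" "x \<le> \<beta>" for x
    proof -
      \<comment> \<open>The fraction of the final stretch still ahead. In it \<open>g'\<close>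
        splits into a nonnegative term and \<open>- m\<close> times
        \<open>3 * \<theta>^2 - 2 * \<theta>\<close>, which is below 1.\<close>
      define \<theta> where "\<theta> = (\<beta> - x) / e"
      have \<theta>: "0 \<le> \<theta>" "\<theta> < 1" and x: "\<beta> - x = \<theta> * e"
        using that e \<beta> by (auto simp: \<theta>_def field_simps)
      have "g' x = - (m * (3 * \<theta>\<^sup>2 - 2 * \<theta>)) + 6 * h / e * (\<theta> * (1 - \<theta>))"
        unfolding g'_def x using e by (simp add: P_def Q_def field_simps power2_eq_square)
      also have "\<dots> \<ge> - (m * (3 * \<theta>\<^sup>2 - 2 * \<theta>))"
        using \<theta> h e by simp
      finally have "g' x \<ge> - (m * (3 * \<theta>\<^sup>2 - 2 * \<theta>))" .
      moreover have "(3 * \<theta> + 1) * (\<theta> - 1) < 0"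
        using \<theta> by (intro mult_pos_neg) auto
      then have "3 * \<theta>\<^sup>2 - 2 * \<theta> < 1"
        by (simp add: algebra_simps power2_eq_square)
      then have "m * (3 * \<theta>\<^sup>2 - 2 * \<theta>) < m * 1"
        using m by (intro mult_strict_left_mono)
      ultimately show ?thesis by simp
    qed
    ultimately show "v' c < v' x" if "x \<noteq> c" for x
      using that m ord by (auto simp: v'_def)
    \<comment> \<open>The extra \<open>k * e\<close> pays for slopes short of full steepness:
      clearing denominators, \<open>m \<le> k * h\<close> becomes
      \<open>l + 2 * e \<le> k * l * (l + e)\<close>.\<close>
    have "k * l = 1 + k * e"
      using k by (simp add: l_def field_simps)
    then have "l + 2 * e \<le> (k * l) * (l + e)"
      using k e l by (simp add: algebra_simps)
    then have "m \<le> k * h"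
      using e l by (simp add: m_def h_def divide_simps power2_eq_square)
    then show "k * v c \<le> v' c"
      using ord at_c by (simp add: v_def v'_def)
  qed
qed

theorem theorem1p2:
  fixes k \<alpha>0 \<beta>0 s0 :: real
  assumes "k > 0"
    and "s0 = \<beta>0 - \<alpha>0"
  shows "(s0 \<le> 1 / k \<longrightarrow>
            (\<forall>u0 z0. initial_datum \<alpha>0 \<beta>0 u0 \<and> global_min_point (deriv u0) z0 \<longrightarrow>
               blows_up_on_characteristic k u0 z0)) \<and>
         (s0 > 1 / k \<longrightarrow>
            (\<exists>u0. initial_datum \<alpha>0 \<beta>0 u0 \<and>
               (\<exists>z0. global_min_point (deriv u0) z0) \<and>
               (\<forall>z0. global_min_point (deriv u0) z0 \<longrightarrow>
                  exists_globally_on_characteristic k u0 z0)))"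
proof (intro conjI impI allI)
  fix u0 z0
  assume "s0 \<le> 1 / k" "initial_datum \<alpha>0 \<beta>0 u0 \<and> global_min_point (deriv u0) z0"
  then show "blows_up_on_characteristic k u0 z0"
    using assms by (auto intro: blows_up_if_support_short)
next
  assume "s0 > 1 / k"
  then have long: "\<beta>0 - \<alpha>0 > 1 / k"
    using assms(2) by simp
  obtain v v' c where v: "\<And>x. (v has_real_derivative v' x) (at x)" "continuous_on UNIV v'"
    and supp: "\<And>x. x \<notin> {\<alpha>0..\<beta>0} \<Longrightarrow> v x = 0" and neg: "v c < 0"
    and min: "\<And>x. x \<noteq> c \<Longrightarrow> v' c < v' x" and slope: "k * v c \<le> v' c"
    using late_minimum_profile[OF \<open>k > 0\<close> long] by blast
  interpret burgers_datum k v v'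
    using assms(1) v by unfold_locales
  have "deriv v = v'"
    using v(1) DERIV_imp_deriv by blast
  \<comment> \<open>Because the minimum is strict, a claim about every minimum point concerns
    \<open>c\<close> alone.\<close>
  moreover have "global_min_point v' z \<longleftrightarrow> z = c" for z
    using min less_le_not_le unfolding global_min_point_def by (metis order_refl less_imp_le)
  moreover have "closure {x. v x \<noteq> 0} \<subseteq> {\<alpha>0..\<beta>0}"
    by (intro closure_minimal) (use supp in blast)+
  then have "initial_datum \<alpha>0 \<beta>0 v"
    unfolding initial_datum_def C1_differentiable_on_def
    using v neg less_imp_neq[OF neg]
    by (auto simp: has_real_derivative_iff_has_vector_derivative intro!: exI[of _ c])
  moreover have "exists_globally_on_characteristic k v c"
    using neg slope by (intro exists_globally_on_characteristicI) auto
  ultimately show "\<exists>u0. initial_datum \<alpha>0 \<beta>0 u0 \<and>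
       (\<exists>z0. global_min_point (deriv u0) z0) \<and>
       (\<forall>z0. global_min_point (deriv u0) z0 \<longrightarrow> exists_globally_on_characteristic k u0 z0)"
    by (intro exI[of _ v]) simp
qed

end
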